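(* Let $\Gamma$ be a directed graph and $I(\Gamma)$ its graph inverse semigroup. The non-zero idempotents of $I(\Gamma)$ are precisely the elements $pp^*$ with $p$ a directed path in $\Gamma$, and the maximal elements of the set of idempotents $E(I(\Gamma))$ with respect to the natural partial order are precisely the vertices of $\Gamma$.
   Context: A directed graph $\Gamma$ consists of a non-empty set $\Gamma^0$ of vertices, a possibly empty set $\Gamma^1$ of edges, and source and range maps $s,r:\Gamma^1\to\Gamma^0$. A directed path is either a vertex $v$ (trivial path, $s(v)=r(v)=v$) or a finite sequence $p=e_1e_2\cdots e_n$ of edges with $r(e_i)=s(e_{i+1})$ for $1\le i\le n-1$. For each edge $e$ there is an inverse (ghost) edge $e^*$ with $s(e^* )=r(e)$, $r(e^* )=s(e)$; $(\Gamma^1)^*$ is the set of ghost edges. For a path $p=e_1\cdots e_n$, $p^*=e_n^*\cdots e_1^*$, and $v^*=v$ for a vertex $v$. The graph inverse semigroup $I(\Gamma)$ is the semigroup with zero $0$ generated by $\Gamma^0\cup\Gamma^1\cup(\Gamma^1)^*$ subject to the relations: (1) $s(e)e=e=e\,r(e)$ for all $e\in\Gamma^0\cup\Gamma^1\cup(\Gamma^1)^*$; (2) $uv=u$ if $u=v$ and $uv=0$ if $u\neq v$, for all $u,v\in\Gamma^0$; (3) $e^*f=r(e)$ if $e=f$ and $e^*f=0$ if $e\ne f$, for all $e,f\in\Gamma^1$. The zero element is always included in $I(\Gamma)$. $I(\Gamma)$ is an inverse semigroup; its set of idempotents $E(I(\Gamma))$ is ordered by the natural partial order: $e\le f$ if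 and only if $e=ef=fe$. *)

theory Defs
  imports "Graph_Theory.Arc_Walk"
begin

datatype ('a, 'b) gis_gen = Vertex 'a | Edge 'b | Ghost 'b

fun gen_source :: "('a, 'b) pre_digraph \<Rightarrow> ('a, 'b) gis_gen \<Rightarrow> 'a" where
  "gen_source G (Vertex v) = v"
| "gen_source G (Edge e) = tail G e"
| "gen_source G (Ghost e) = head G e"

fun gen_range :: "('a, 'b) pre_digraph \<Rightarrow> ('a, 'b) gis_gen \<Rightarrow> 'a" where
  "gen_range G (Vertex v) = v"
| "gen_range G (Edge e) = head G e"
| "gen_range G (Ghost e) = tail G e"

definition gis_gens :: "('a, 'b) pre_digraph \<Rightarrow> ('a, 'b) gis_gen set" where
  "gis_gens G = Vertex ` verts G \<union> Edge ` arcs G \<union> Ghost ` arcs G"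

text \<open>\<open>None\<close> is the zero; \<open>Some w\<close> with \<open>w\<close> non-empty is an element of the free semigroup.\<close>

type_synonym ('a, 'b) gis_word = "('a, 'b) gis_gen list option"

definition gis_words :: "('a, 'b) pre_digraph \<Rightarrow> ('a, 'b) gis_word set" where
  "gis_words G = insert None (Some ` {w. w \<noteq> [] \<and> set w \<subseteq> gis_gens G})"

fun word_mult :: "('a, 'b) gis_word \<Rightarrow> ('a, 'b) gis_word \<Rightarrow> ('a, 'b) gis_word" where
  "word_mult (Some x) (Some y) = Some (x @ y)"
| "word_mult _ _ = None"

inductive_set gis_rels :: "('a, 'b) pre_digraph \<Rightarrow> ('a, 'b) gis_word rel"
  for G :: "('a, 'b) pre_digraph" where
  source: "x \<in> gis_gens G \<Longrightarrow> (Some [Vertex (gen_source G x), x], Some [x]) \<in> gis_rels G"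
| range: "x \<in> gis_gens G \<Longrightarrow> (Some [x, Vertex (gen_range G x)], Some [x]) \<in> gis_rels G"
| vertex_idem: "u \<in> verts G \<Longrightarrow> (Some [Vertex u, Vertex u], Some [Vertex u]) \<in> gis_rels G"
| vertex_orth: "u \<in> verts G \<Longrightarrow> v \<in> verts G \<Longrightarrow> u \<noteq> v \<Longrightarrow>
    (Some [Vertex u, Vertex v], None) \<in> gis_rels G"
| ghost_edge: "e \<in> arcs G \<Longrightarrow> (Some [Ghost e, Edge e], Some [Vertex (head G e)]) \<in> gis_rels G"
| ghost_orth: "e \<in> arcs G \<Longrightarrow> f \<in> arcs G \<Longrightarrow> e \<noteq> f \<Longrightarrow>
    (Some [Ghost e, Edge f], None) \<in> gis_rels G"

inductive_set gis_cong :: "('a, 'b) pre_digraph \<Rightarrow> ('a, 'b) gis_word rel"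
  for G :: "('a, 'b) pre_digraph" where
  base: "(x, y) \<in> gis_rels G \<Longrightarrow> (x, y) \<in> gis_cong G"
| refl: "x \<in> gis_words G \<Longrightarrow> (x, x) \<in> gis_cong G"
| sym: "(x, y) \<in> gis_cong G \<Longrightarrow> (y, x) \<in> gis_cong G"
| trans: "(x, y) \<in> gis_cong G \<Longrightarrow> (y, z) \<in> gis_cong G \<Longrightarrow> (x, z) \<in> gis_cong G"
| left: "(x, y) \<in> gis_cong G \<Longrightarrow> z \<in> gis_words G \<Longrightarrow>
    (word_mult z x, word_mult z y) \<in> gis_cong G"
| right: "(x, y) \<in> gis_cong G \<Longrightarrow> z \<in> gis_words G \<Longrightarrow>
    (word_mult x z, word_mult y z) \<in> gis_cong G"

definition gis_class :: "('a, 'b) pre_digraph \<Rightarrow> ('a, 'b) gis_word \<Rightarrow> ('a, 'b) gis_word set" where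
  "gis_class G x = gis_cong G `` {x}"

definition gis_carrier :: "('a, 'b) pre_digraph \<Rightarrow> ('a, 'b) gis_word set set" where
  "gis_carrier G = gis_words G // gis_cong G"

definition gis_mult :: "('a, 'b) pre_digraph \<Rightarrow>
    ('a, 'b) gis_word set \<Rightarrow> ('a, 'b) gis_word set \<Rightarrow> ('a, 'b) gis_word set" where
  "gis_mult G A B = (\<Union>x\<in>A. \<Union>y\<in>B. gis_class G (word_mult x y))"

definition gis_zero :: "('a, 'b) pre_digraph \<Rightarrow> ('a, 'b) gis_word set" where
  "gis_zero G = gis_class G None"

definition gis_vertex :: "('a, 'b) pre_digraph \<Rightarrow> 'a \<Rightarrow> ('a, 'b) gis_word set" where
  "gis_vertex G v = gis_class G (Some [Vertex v])"

text \<open>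
  A directed path is given by its source \<open>u\<close> and its list of edges \<open>p\<close>, as in
  \<^const>\<open>pre_digraph.awalk\<close>; the empty list encodes the trivial path \<open>u\<close>.
\<close>

definition gis_path :: "('a, 'b) pre_digraph \<Rightarrow> 'a \<Rightarrow> 'b list \<Rightarrow> ('a, 'b) gis_word set" where
  "gis_path G u p = (if p = [] then gis_vertex G u else gis_class G (Some (map Edge p)))"

definition gis_path_star :: "('a, 'b) pre_digraph \<Rightarrow> 'a \<Rightarrow> 'b list \<Rightarrow> ('a, 'b) gis_word set" where
  "gis_path_star G u p =
    (if p = [] then gis_vertex G u else gis_class G (Some (map Ghost (rev p))))"

definition gis_idempotents :: "('a, 'b) pre_digraph \<Rightarrow> ('a, 'b) gis_word set set" where
  "gis_idempotents G = {x \<in> gis_carrier G. gis_mult G x x = x}"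

definition gis_le :: "('a, 'b) pre_digraph \<Rightarrow>
    ('a, 'b) gis_word set \<Rightarrow> ('a, 'b) gis_word set \<Rightarrow> bool" where
  "gis_le G x y \<longleftrightarrow> x = gis_mult G x y \<and> x = gis_mult G y x"

definition gis_maximal_idempotents :: "('a, 'b) pre_digraph \<Rightarrow> ('a, 'b) gis_word set set" where
  "gis_maximal_idempotents G =
    {x \<in> gis_idempotents G. \<forall>y \<in> gis_idempotents G. gis_le G x y \<longrightarrow> y = x}"

lemma word_mult_closed:
  "x \<in> gis_words G \<Longrightarrow> y \<in> gis_words G \<Longrightarrow> word_mult x y \<in> gis_words G"
  by (cases x; cases y) (auto simp: gis_words_def)

lemma word_mult_assoc: "word_mult (word_mult x y) z = word_mult x (word_mult y z)"
  by (cases x; cases y; cases z) auto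

lemma gis_cong_words:
  assumes "wf_digraph G" and "(x, y) \<in> gis_cong G"
  shows "x \<in> gis_words G \<and> y \<in> gis_words G"
  using assms(2)
proof induction
  case (base x y)
  then show ?case
    using wf_digraph.head_in_verts[OF assms(1)] wf_digraph.tail_in_verts[OF assms(1)]
    by cases (auto simp: gis_words_def gis_gens_def)
qed (auto intro: word_mult_closed)

lemma equiv_gis_cong:
  assumes "wf_digraph G"
  shows "equiv (gis_words G) (gis_cong G)"
proof (rule equivI)
  show "gis_cong G \<subseteq> gis_words G \<times> gis_words G"
    using gis_cong_words[OF assms] by auto
  show "refl_on (gis_words G) (gis_cong G)"
    by (auto intro: refl_onI gis_cong.refl)
  show "sym (gis_cong G)" by (auto intro: symI gis_cong.sym)
  show "trans (gis_cong G)" by (auto intro: transI gis_cong.trans)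
qed

lemma gis_mult_class:
  assumes "wf_digraph G" "x \<in> gis_words G" "y \<in> gis_words G"
  shows "gis_mult G (gis_class G x) (gis_class G y) = gis_class G (word_mult x y)"
proof -
  have "(word_mult a b, word_mult a' b') \<in> gis_cong G"
    if "(a, a') \<in> gis_cong G" "(b, b') \<in> gis_cong G" for a a' b b'
    using that gis_cong_words[OF assms(1)] by (meson gis_cong.left gis_cong.right gis_cong.trans)
  then have "congruent2 (gis_cong G) (gis_cong G) (\<lambda>a b. gis_class G (word_mult a b))"
    unfolding gis_class_def
    by (intro congruent2I' equiv_class_eq[OF equiv_gis_cong[OF assms(1)]])
  from UN_equiv_class2[OF equiv_gis_cong equiv_gis_cong this, OF assms(1) assms(1) assms(2,3)]
  show ?thesis by (simp add: gis_mult_def gis_class_def)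
qed

end

theory Submission
  imports Defs
begin

text \<open>
  The proof replaces the presented semigroup by a concrete one. A word acts on pairs \<open>(a, s)\<close>,
  thought of as a path \<open>s\<close> with source \<open>a\<close>: an edge is put in front of a path that starts at its
  head, a ghost edge deletes that edge from the front, and a vertex is the identity on the paths
  starting there. The defining relations hold for these partial maps, so congruent words
  act alike (\<open>rep_cong\<close>).

  Conversely, the relations suffice to bring each word into the form \<open>p q\<^sup>*\<close> or to make it zero
  (\<open>normal_form\<close>). The word \<open>p q\<^sup>*\<close> replaces the prefix \<open>q\<close> by \<open>p\<close>, and this map remembers \<open>p\<close> and
  \<open>q\<close>: the path \<open>q\<close> is the shortest one in its domain, and it is sent to \<open>p\<close>. Hence the action is
  faithful (\<open>class_eq_iff\<close>), and equations between elements can be decided by comparing partial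
  maps.

  If \<open>q t \<mapsto> p t\<close> is idempotent, then it fixes its value \<open>p\<close>; this makes \<open>p\<close> an extension \<open>q t\<close> of
  \<open>q\<close> with \<open>p t = p\<close>, so \<open>p = q\<close>. Thus the idempotents act as identities on the sets of paths with
  a fixed prefix \<open>p\<close>, or on the empty set, and the order between them is inclusion of
  these sets. The largest such sets are those with \<open>p\<close> trivial, which belong to the vertices; as there
  is a vertex, the empty set is not among them.
\<close>

section \<open>The action on paths\<close>

text \<open>
  Only the source of the path is tested, not whether consecutive edges match: the relations hold
  on all pairs, and so no side condition about walks has to be carried along.
\<close>

fun act :: "('a, 'b) pre_digraph \<Rightarrow> ('a, 'b) gis_gen \<Rightarrow> 'a \<times> 'b list \<Rightarrow> ('a \<times> 'b list) option" where
  "act G (Vertex v) (a, s) = (if a = v then Some (a, s) else None)"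
| "act G (Edge e) (a, s) = (if a = head G e then Some (tail G e, e # s) else None)"
| "act G (Ghost e) (a, s) =
    (case s of [] \<Rightarrow> None
     | f # t \<Rightarrow> if f = e \<and> a = tail G e then Some (head G e, t) else None)"

definition word_act ::
    "('a, 'b) pre_digraph \<Rightarrow> ('a, 'b) gis_gen list \<Rightarrow> 'a \<times> 'b list \<Rightarrow> ('a \<times> 'b list) option" where
  "word_act G w = foldr (\<lambda>x f. act G x \<circ>\<^sub>m f) w Some"

definition rep ::
    "('a, 'b) pre_digraph \<Rightarrow> ('a, 'b) gis_word \<Rightarrow> 'a \<times> 'b list \<Rightarrow> ('a \<times> 'b list) option" where
  "rep G x = (case x of None \<Rightarrow> Map.empty | Some w \<Rightarrow> word_act G w)"

lemma word_act_Nil [simp]: "word_act G [] = Some"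
  and word_act_Cons [simp]: "word_act G (x # w) = act G x \<circ>\<^sub>m word_act G w"
  by (simp_all add: word_act_def)

lemma rep_simps [simp]: "rep G None = Map.empty" "rep G (Some w) = word_act G w"
  by (simp_all add: rep_def)

lemma map_comp_assoc: "(f \<circ>\<^sub>m g) \<circ>\<^sub>m h = f \<circ>\<^sub>m (g \<circ>\<^sub>m h)"
  by (rule ext) (simp add: map_comp_def split: option.split)

lemma map_comp_Some [simp]: "Some \<circ>\<^sub>m f = f" "f \<circ>\<^sub>m Some = f"
  by (auto simp: map_comp_def fun_eq_iff split: option.split)

lemma word_act_append: "word_act G (w @ w') = word_act G w \<circ>\<^sub>m word_act G w'"
  by (induction w) (simp_all add: map_comp_assoc)

lemma rep_mult: "rep G (word_mult x y) = rep G x \<circ>\<^sub>m rep G y"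
  by (cases x; cases y) (auto simp: word_act_append)

lemma rep_rels: "(x, y) \<in> gis_rels G \<Longrightarrow> rep G x = rep G y"
proof (induction rule: gis_rels.induct)
  case (source x)
  show ?case
    by (cases x) (auto simp: map_comp_def fun_eq_iff split: option.split list.split)
next
  case (range x)
  show ?case
    by (cases x) (auto simp: map_comp_def fun_eq_iff split: option.split list.split)
qed (auto simp: map_comp_def fun_eq_iff)

lemma rep_cong: "(x, y) \<in> gis_cong G \<Longrightarrow> rep G x = rep G y"
  by (induction rule: gis_cong.induct) (simp_all add: rep_rels rep_mult)

section \<open>Normal forms\<close>

text \<open>
  The element \<open>p q\<^sup>*\<close>, where \<open>p\<close> starts at \<open>u\<close> and \<open>q\<close> at \<open>v\<close>. The outer vertices make trivial
  paths no special case.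
\<close>

definition nf :: "'a \<Rightarrow> 'b list \<Rightarrow> 'a \<Rightarrow> 'b list \<Rightarrow> ('a, 'b) gis_gen list" where
  "nf u p v q = Vertex u # map Edge p @ map Ghost (rev q) @ [Vertex v]"

definition replace_prefix :: "'a \<Rightarrow> 'b list \<Rightarrow> 'a \<Rightarrow> 'b list \<Rightarrow> 'a \<times> 'b list \<Rightarrow> ('a \<times> 'b list) option"
  where "replace_prefix u p v q =
    (\<lambda>(a, s). if a = v \<and> take (length q) s = q then Some (u, p @ drop (length q) s) else None)"

lemma replace_prefix_eq_Some_iff:
  "replace_prefix u p v q (a, s) = Some y \<longleftrightarrow> (\<exists>t. a = v \<and> s = q @ t \<and> y = (u, p @ t))"
  by (auto simp: replace_prefix_def) (metis append_take_drop_id)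

text \<open>A path is recovered as the shortest element of the domain, the other one as its image.\<close>

lemma replace_prefix_inject:
  assumes "replace_prefix u p v q = replace_prefix u' p' v' q'"
  shows "u = u' \<and> p = p' \<and> v = v' \<and> q = q'"
proof -
  have "replace_prefix u' p' v' q' (v, q) = Some (u, p)"
    unfolding assms[symmetric] by (simp add: replace_prefix_eq_Some_iff)
  moreover have "replace_prefix u p v q (v', q') = Some (u', p')"
    unfolding assms by (simp add: replace_prefix_eq_Some_iff)
  ultimately show ?thesis by (auto simp: replace_prefix_eq_Some_iff)
qed

text \<open>
  An idempotent map fixes its values, in particular the value \<open>p\<close> at \<open>q\<close>; so \<open>p = q t\<close>, while the
  image of \<open>q t\<close> is \<open>p t\<close>.
\<close>

lemma replace_prefix_idem_iff:
  "replace_prefix u p v q \<circ>\<^sub>m replace_prefix u p v q = replace_prefix u p v q \<longleftrightarrow> u = v \<and> p = q"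
  (is "?f \<circ>\<^sub>m ?f = ?f \<longleftrightarrow> _")
proof
  assume idem: "?f \<circ>\<^sub>m ?f = ?f"
  have val: "?f (v, q) = Some (u, p)" by (simp add: replace_prefix_eq_Some_iff)
  with fun_cong[OF idem, of "(v, q)"] have "?f (u, p) = Some (u, p)"
    by (simp add: map_comp_def)
  then show "u = v \<and> p = q" by (auto simp: replace_prefix_eq_Some_iff)
next
  assume "u = v \<and> p = q"
  then show "?f \<circ>\<^sub>m ?f = ?f"
    by (auto simp: replace_prefix_def map_comp_def fun_eq_iff)
qed

lemma word_act_vertex: "word_act G [Vertex v] = replace_prefix v [] v []"
  by (auto simp: replace_prefix_def map_comp_def fun_eq_iff)

lemma word_act_edges:
  assumes "pre_digraph.cas G u p z"
  shows "word_act G (Vertex u # map Edge p) = replace_prefix u p z []"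
  using assms
proof (induction p arbitrary: u)
  case Nil
  then show ?case by (simp add: pre_digraph.cas.simps word_act_vertex[simplified])
next
  case (Cons e p)
  then have IH: "word_act G (Vertex (head G e) # map Edge p) = replace_prefix (head G e) p z []"
    and u: "tail G e = u"
    by (auto simp: pre_digraph.cas.simps)
  have "word_act G (Vertex u # map Edge (e # p))
      = act G (Vertex u) \<circ>\<^sub>m (act G (Edge e) \<circ>\<^sub>m word_act G (map Edge p))" by simp
  also have "\<dots> = act G (Edge e) \<circ>\<^sub>m (act G (Vertex (head G e)) \<circ>\<^sub>m word_act G (map Edge p))"
    using u by (auto simp: map_comp_def fun_eq_iff split: option.split)
  also have "\<dots> = act G (Edge e) \<circ>\<^sub>m replace_prefix (head G e) p z []" using IH by simp
  also have "\<dots> = replace_prefix u (e # p) z []"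
    using u by (auto simp: replace_prefix_def map_comp_def fun_eq_iff)
  finally show ?case .
qed

lemma word_act_ghosts:
  assumes "pre_digraph.cas G v q z"
  shows "word_act G (map Ghost (rev q) @ [Vertex v]) = replace_prefix z [] v q"
  using assms
proof (induction q arbitrary: v)
  case Nil
  then show ?case by (simp add: pre_digraph.cas.simps word_act_vertex[simplified])
next
  case (Cons e q)
  then have IH: "word_act G (map Ghost (rev q) @ [Vertex (head G e)])
        = replace_prefix z [] (head G e) q"
    and v: "tail G e = v"
    by (auto simp: pre_digraph.cas.simps)
  have "word_act G (map Ghost (rev (e # q)) @ [Vertex v])
      = word_act G (map Ghost (rev q)) \<circ>\<^sub>m word_act G [Ghost e, Vertex v]"
    by (simp add: word_act_append map_comp_assoc)
  also have "word_act G [Ghost e, Vertex v] = word_act G [Vertex (head G e), Ghost e]"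
    using v by (auto simp: map_comp_def fun_eq_iff split: option.split list.split)
  also have "word_act G (map Ghost (rev q)) \<circ>\<^sub>m word_act G [Vertex (head G e), Ghost e]
      = word_act G (map Ghost (rev q) @ [Vertex (head G e)]) \<circ>\<^sub>m word_act G [Ghost e]"
    by (simp add: word_act_append map_comp_assoc)
  also have "\<dots> = replace_prefix z [] (head G e) q \<circ>\<^sub>m word_act G [Ghost e]" using IH by simp
  also have "\<dots> = replace_prefix z [] v (e # q)"
    using v by (auto simp: replace_prefix_def map_comp_def fun_eq_iff split: list.split option.split)
  finally show ?case .
qed

lemma word_act_nf:
  assumes "pre_digraph.cas G u p z" "pre_digraph.cas G v q z"
  shows "word_act G (nf u p v q) = replace_prefix u p v q"
proof -
  have "word_act G (nf u p v q)
      = word_act G (Vertex u # map Edge p) \<circ>\<^sub>m word_act G (map Ghost (rev q) @ [Vertex v])"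
    unfolding nf_def by (simp add: map_comp_assoc word_act_append)
  also have "\<dots> = replace_prefix u p v q"
    unfolding word_act_edges[OF assms(1)] word_act_ghosts[OF assms(2)]
    by (auto simp: replace_prefix_def map_comp_def fun_eq_iff)
  finally show ?thesis .
qed

context wf_digraph
begin

lemma gen_ends_in_verts:
  "x \<in> gis_gens G \<Longrightarrow> gen_source G x \<in> verts G \<and> gen_range G x \<in> verts G"
  by (auto simp: gis_gens_def)

lemma Vertex_gens [simp]: "Vertex v \<in> gis_gens G \<longleftrightarrow> v \<in> verts G"
  and Edge_gens [simp]: "Edge e \<in> gis_gens G \<longleftrightarrow> e \<in> arcs G"
  and Ghost_gens [simp]: "Ghost e \<in> gis_gens G \<longleftrightarrow> e \<in> arcs G"
  by (auto simp: gis_gens_def)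

lemma Some_words [simp]: "Some w \<in> gis_words G \<longleftrightarrow> w \<noteq> [] \<and> set w \<subseteq> gis_gens G"
  and None_words [simp]: "None \<in> gis_words G"
  by (auto simp: gis_words_def)

text \<open>
  The factors may be empty here, although the empty word is not an element of the free semigroup.
\<close>

lemma cong_context:
  assumes "(Some w, y) \<in> gis_cong G" "set a \<subseteq> gis_gens G" "set b \<subseteq> gis_gens G"
  shows "(Some (a @ w @ b), map_option (\<lambda>w'. a @ w' @ b) y) \<in> gis_cong G"
proof -
  have "(Some (a @ w), map_option (\<lambda>w'. a @ w') y) \<in> gis_cong G"
  proof (cases "a = []")
    case False
    with assms(2) gis_cong.left[OF assms(1), of "Some a"] show ?thesis by (cases y) auto
  qed (use assms(1) in \<open>cases y; simp\<close>)
  then have "(Some ((a @ w) @ b), map_option (\<lambda>w'. w' @ b) (map_option (\<lambda>w'. a @ w') y)) \<in> gis_cong G"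
  proof (cases "b = []")
    case False
    with assms(3) gis_cong.right[OF \<open>(Some (a @ w), _) \<in> _\<close>, of "Some b"] show ?thesis
      by (cases y) auto
  qed (simp add: option.map_ident)
  then show ?thesis by (simp add: option.map_comp comp_def)
qed

lemma gen_vertex_zero:
  assumes "x \<in> gis_gens G" "u \<in> verts G" "gen_range G x \<noteq> u"
  shows "(Some [x, Vertex u], None) \<in> gis_cong G"
proof -
  have "(Some [x, Vertex u], Some [x, Vertex (gen_range G x), Vertex u]) \<in> gis_cong G"
    using cong_context[OF gis_cong.base[OF gis_rels.range[OF assms(1)]], of "[]" "[Vertex u]"] assms
    by (auto intro: gis_cong.sym)
  moreover have "(Some [x, Vertex (gen_range G x), Vertex u], None) \<in> gis_cong G"
    using cong_context[OF gis_cong.base[OF gis_rels.vertex_orth], of "gen_range G x" u "[x]" "[]"]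
      assms gen_ends_in_verts by auto
  ultimately show ?thesis by (rule gis_cong.trans)
qed

definition is_nf :: "('a, 'b) gis_gen list \<Rightarrow> 'a \<Rightarrow> bool" where
  "is_nf w v \<longleftrightarrow> (\<exists>u p q z. awalk u p z \<and> awalk v q z \<and> w = nf u p v q)"

lemma is_nfI: "awalk u p z \<Longrightarrow> awalk v q z \<Longrightarrow> is_nf (nf u p v q) v"
  by (auto simp: is_nf_def)

lemma nf_gens:
  assumes "awalk u p z" "awalk v q z"
  shows "set (nf u p v q) \<subseteq> gis_gens G"
  using assms by (auto simp: awalk_def nf_def)

text \<open>
  The case that matters is a ghost edge \<open>e\<^sup>*\<close> meeting \<open>p\<close>: it cancels against the first edge of \<open>p\<close>,
  or annihilates it, and if \<open>p\<close> is trivial then it is absorbed into \<open>q\<^sup>*\<close>.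
\<close>

lemma gen_times_nf:
  assumes x: "x \<in> gis_gens G" and p: "awalk u p z" and q: "awalk v q z"
  shows "(Some (x # nf u p v q), None) \<in> gis_cong G
    \<or> (\<exists>w. is_nf w v \<and> (Some (x # nf u p v q), Some w) \<in> gis_cong G)"
proof -
  define r where "r = map Edge p @ map Ghost (rev q) @ [Vertex v]"
  have r: "set r \<subseteq> gis_gens G" and u: "u \<in> verts G"
    using p q by (auto simp: r_def awalk_def)
  have nf: "x # nf u p v q = [x, Vertex u] @ r" by (simp add: nf_def r_def)
  show ?thesis
  proof (cases "gen_range G x = u")
    case False
    then show ?thesis
      using cong_context[OF gen_vertex_zero[OF x u], of "[]" r] r nf by auto
  next
    case True
    have "(Some [x, Vertex u], Some [Vertex (gen_source G x), x]) \<in> gis_cong G"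
      using gis_rels.range[OF x] gis_rels.source[OF x] True
      by (metis gis_cong.base gis_cong.sym gis_cong.trans)
    from cong_context[OF this, of "[]" r] r
    have step: "(Some (x # nf u p v q), Some (Vertex (gen_source G x) # x # r)) \<in> gis_cong G"
      by (simp add: nf)
    show ?thesis
    proof (cases x)
      case (Vertex t)
      with True have t: "t = u" by simp
      have "(Some (Vertex u # Vertex u # r), Some (Vertex u # r)) \<in> gis_cong G"
        using cong_context[OF gis_cong.base[OF gis_rels.vertex_idem[OF u]], of "[]" r] r by simp
      with step Vertex t have "(Some (x # nf u p v q), Some (nf u p v q)) \<in> gis_cong G"
        by (auto simp: nf_def r_def intro: gis_cong.trans)
      then show ?thesis using is_nfI[OF p q] by blast
    next
      case (Edge e)
      then have "awalk (tail G e) (e # p) z" using x p True by (simp add: awalk_Cons_iff)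
      moreover have "Vertex (tail G e) # x # r = nf (tail G e) (e # p) v q"
        by (simp add: nf_def r_def Edge)
      ultimately show ?thesis using step Edge is_nfI[OF _ q] by (metis gen_source.simps(2))
    next
      case (Ghost e)
      then have e: "e \<in> arcs G" "tail G e = u" using x True by auto
      show ?thesis
      proof (cases p)
        case Nil
        then have "u = z" using p by auto
        then have "awalk v (q @ [e]) (head G e)"
          using q e by (simp add: awalk_Cons_iff awalk_Nil_iff)
        moreover have "awalk (head G e) [] (head G e)" using e by (simp add: awalk_Nil_iff)
        moreover have "Vertex (head G e) # x # r = nf (head G e) [] v (q @ [e])"
          by (simp add: nf_def r_def Ghost Nil)
        ultimately show ?thesis using step Ghost is_nfI by (metis gen_source.simps(3))
      next
        case (Cons f p')
        then have f: "f \<in> arcs G" and p': "awalk (head G f) p' z"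
          using p by (auto simp: awalk_Cons_iff)
        define r' where "r' = map Edge p' @ map Ghost (rev q) @ [Vertex v]"
        have r': "set r' \<subseteq> gis_gens G" using r by (simp add: r_def r'_def Cons)
        have eq: "Vertex (gen_source G x) # x # r
            = [Vertex (head G e)] @ [Ghost e, Edge f] @ r'"
          by (simp add: r_def r'_def Cons Ghost)
        have h: "head G e \<in> verts G" using e by simp
        show ?thesis
        proof (cases "e = f")
          case False
          from cong_context[OF gis_cong.base[OF gis_rels.ghost_orth[OF e(1) f False]],
              of "[Vertex (head G e)]" r'] r' h step
          show ?thesis unfolding eq by (auto intro: gis_cong.trans)
        next
          case True
          have "(Some ([Vertex (head G e)] @ [Ghost e, Edge f] @ r'),
              Some (Vertex (head G e) # Vertex (head G e) # r')) \<in> gis_cong G"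
            using cong_context[OF gis_cong.base[OF gis_rels.ghost_edge[OF e(1)]],
              of "[Vertex (head G e)]" r'] r' h True by simp
          moreover have "(Some (Vertex (head G e) # Vertex (head G e) # r'),
              Some (Vertex (head G e) # r')) \<in> gis_cong G"
            using cong_context[OF gis_cong.base[OF gis_rels.vertex_idem[OF h]], of "[]" r'] r'
            by simp
          ultimately have "(Some (x # nf u p v q), Some (nf (head G e) p' v q)) \<in> gis_cong G"
            using step unfolding eq by (auto simp: nf_def r'_def intro: gis_cong.trans)
          then show ?thesis using is_nfI[OF p' q] True by blast
        qed
      qed
    qed
  qed
qed

text \<open>
  Appending a vertex gives the induction over words a base case, the idempotent \<open>v v\<^sup>*\<close>.
\<close>

lemma normal_form_vertex:
  assumes "set w \<subseteq> gis_gens G" "v \<in> verts G"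
  shows "(Some (w @ [Vertex v]), None) \<in> gis_cong G
    \<or> (\<exists>w'. is_nf w' v \<and> (Some (w @ [Vertex v]), Some w') \<in> gis_cong G)"
  using assms(1)
proof (induction w)
  case Nil
  have "(Some [Vertex v], Some [Vertex v, Vertex v]) \<in> gis_cong G"
    using gis_rels.vertex_idem[OF assms(2)] by (auto intro: gis_cong.sym gis_cong.base)
  moreover have "is_nf [Vertex v, Vertex v] v"
    using assms(2) is_nfI[of v "[]" v v "[]"] by (simp add: nf_def awalk_Nil_iff)
  ultimately show ?case by auto
next
  case (Cons x w)
  then have x: "x \<in> gis_gens G" by simp
  consider "(Some (w @ [Vertex v]), None) \<in> gis_cong G"
    | u p q z where "awalk u p z" "awalk v q z"
        "(Some (w @ [Vertex v]), Some (nf u p v q)) \<in> gis_cong G"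
    using Cons unfolding is_nf_def by auto
  then show ?case
  proof cases
    case 1
    from cong_context[OF this, of "[x]" "[]"] x show ?thesis by simp
  next
    case 2
    from cong_context[OF this(3), of "[x]" "[]"] x
    have "(Some ((x # w) @ [Vertex v]), Some (x # nf u p v q)) \<in> gis_cong G" by simp
    then show ?thesis using gen_times_nf[OF x 2(1,2)] by (blast intro: gis_cong.trans)
  qed
qed

lemma normal_form:
  assumes "x \<in> gis_words G"
  obtains "(x, None) \<in> gis_cong G"
  | u p v q z where "awalk u p z" "awalk v q z" "(x, Some (nf u p v q)) \<in> gis_cong G"
proof (cases x)
  case None
  then show thesis using that(1) gis_cong.refl[OF assms] by simp
next
  case (Some w)
  then obtain w' y where w: "w = w' @ [y]" using assms by (cases w rule: rev_cases) auto
  then have w': "set w' \<subseteq> gis_gens G" and y: "y \<in> gis_gens G" using assms Some by auto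
  let ?v = "gen_range G y"
  have "(x, Some (w @ [Vertex ?v])) \<in> gis_cong G"
    using cong_context[OF gis_cong.base[OF gis_rels.range[OF y]], of w' "[]"] w' Some w
    by (auto intro: gis_cong.sym)
  moreover have "(Some (w @ [Vertex ?v]), None) \<in> gis_cong G
    \<or> (\<exists>w'. is_nf w' ?v \<and> (Some (w @ [Vertex ?v]), Some w') \<in> gis_cong G)"
    using normal_form_vertex gen_ends_in_verts[OF y] assms Some by simp
  ultimately show thesis using that unfolding is_nf_def by (blast intro: gis_cong.trans)
qed

section \<open>Faithfulness\<close>

lemma rep_nf:
  assumes "awalk u p z" "awalk v q z"
  shows "rep G (Some (nf u p v q)) = replace_prefix u p v q"
  using word_act_nf[of G u p z v q] assms by (simp add: awalk_def)

lemma replace_prefix_not_empty: "replace_prefix u p v q \<noteq> Map.empty"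
proof -
  have "replace_prefix u p v q (v, q) \<noteq> None" by (simp add: replace_prefix_eq_Some_iff)
  then show ?thesis by metis
qed

lemma class_eq_iff:
  assumes x: "x \<in> gis_words G" and y: "y \<in> gis_words G"
  shows "gis_class G x = gis_class G y \<longleftrightarrow> rep G x = rep G y"
proof -
  have "(x, y) \<in> gis_cong G" if eq: "rep G x = rep G y"
    using x
  proof (cases rule: normal_form)
    case x0: 1
    from y show ?thesis
    proof (cases rule: normal_form)
      case 1
      with x0 show ?thesis by (blast intro: gis_cong.trans gis_cong.sym)
    next
      case (2 u p v q z)
      then have "rep G None = replace_prefix u p v q"
        using eq rep_cong[OF x0] rep_cong[OF 2(3)] rep_nf[OF 2(1,2)] by simp
      then show ?thesis using replace_prefix_not_empty by (metis rep_simps(1))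
    qed
  next
    case xn: (2 u p v q z)
    then have rep_x: "rep G x = replace_prefix u p v q" using rep_cong rep_nf by metis
    from y show ?thesis
    proof (cases rule: normal_form)
      case 1
      then show ?thesis using eq rep_x rep_cong replace_prefix_not_empty by (metis rep_simps(1))
    next
      case (2 u' p' v' q' z')
      then have "replace_prefix u p v q = replace_prefix u' p' v' q'"
        using eq rep_x rep_cong rep_nf by metis
      from replace_prefix_inject[OF this] show ?thesis
        using xn(3) 2(3) by (blast intro: gis_cong.trans gis_cong.sym)
    qed
  qed
  then show ?thesis
    unfolding gis_class_def
    using eq_equiv_class_iff[OF equiv_gis_cong[OF wf_digraph_axioms] x y] rep_cong by metis
qed

lemma carrier_eq: "gis_carrier G = gis_class G ` gis_words G"
  by (auto simp: gis_carrier_def gis_class_def quotient_def)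

lemma mult_class:
  assumes "x \<in> gis_words G" "y \<in> gis_words G"
  shows "gis_mult G (gis_class G x) (gis_class G y) = gis_class G (word_mult x y)"
  using gis_mult_class[OF wf_digraph_axioms assms] .

lemma class_idempotent_iff:
  assumes "x \<in> gis_words G"
  shows "gis_class G x \<in> gis_idempotents G \<longleftrightarrow> rep G x \<circ>\<^sub>m rep G x = rep G x"
  using assms
  by (auto simp: gis_idempotents_def carrier_eq mult_class class_eq_iff word_mult_closed rep_mult)

lemma class_le_iff:
  assumes "x \<in> gis_words G" "y \<in> gis_words G"
  shows "gis_le G (gis_class G x) (gis_class G y) \<longleftrightarrow>
    rep G x = rep G x \<circ>\<^sub>m rep G y \<and> rep G x = rep G y \<circ>\<^sub>m rep G x"
  using assms
  by (auto simp: gis_le_def mult_class class_eq_iff word_mult_closed rep_mult)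

section \<open>Idempotents\<close>

lemma path_idem_words:
  assumes "awalk u p z"
  shows "Some (nf u p u p) \<in> gis_words G"
  using nf_gens[OF assms assms] by (auto simp: nf_def)

lemma path_times_star:
  assumes "awalk u p z"
  shows "gis_mult G (gis_path G u p) (gis_path_star G u p) = gis_class G (Some (nf u p u p))"
proof (cases p)
  case Nil
  have "u \<in> verts G" using assms by auto
  then show ?thesis
    by (simp add: Nil gis_path_def gis_path_star_def gis_vertex_def mult_class nf_def)
next
  case (Cons e p')
  have gens: "set p \<subseteq> arcs G" and e: "tail G e = u" using assms Cons by (auto simp: awalk_def)
  have words: "Some (map Edge p) \<in> gis_words G" "Some (map Ghost (rev p)) \<in> gis_words G"
    using gens Cons by auto
  have "act G (Vertex u) \<circ>\<^sub>m act G (Edge e) = act G (Edge e)"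
    "act G (Ghost e) \<circ>\<^sub>m act G (Vertex u) = act G (Ghost e)"
    using e by (auto simp: map_comp_def fun_eq_iff split: option.split list.split)
  then have "rep G (Some (map Edge p @ map Ghost (rev p))) = rep G (Some (nf u p u p))"
    by (simp add: Cons nf_def word_act_append map_comp_assoc)
      (simp flip: map_comp_assoc)
  moreover have "Some (map Edge p @ map Ghost (rev p)) \<in> gis_words G" using words by auto
  ultimately show ?thesis
    using words path_idem_words[OF assms] Cons
    by (simp add: gis_path_def gis_path_star_def mult_class class_eq_iff)
qed

lemma class_zero_iff:
  assumes "x \<in> gis_words G"
  shows "gis_class G x = gis_zero G \<longleftrightarrow> rep G x = Map.empty"
  using class_eq_iff[OF assms None_words] by (simp add: gis_zero_def)

lemma nonzero_idempotents:
  "gis_idempotents G - {gis_zero G} = {gis_class G (Some (nf u p u p)) | u p. \<exists>z. awalk u p z}"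
proof (intro equalityI subsetI)
  fix A assume A: "A \<in> gis_idempotents G - {gis_zero G}"
  then obtain x where x: "x \<in> gis_words G" and Ax: "A = gis_class G x"
    by (auto simp: gis_idempotents_def carrier_eq)
  have idem: "rep G x \<circ>\<^sub>m rep G x = rep G x" and nz: "rep G x \<noteq> Map.empty"
    using A x Ax by (auto simp: class_idempotent_iff class_zero_iff)
  from x show "A \<in> {gis_class G (Some (nf u p u p)) | u p. \<exists>z. awalk u p z}"
  proof (cases rule: normal_form)
    case 1
    then show ?thesis using nz rep_cong by fastforce
  next
    case (2 u p v q z)
    then have rep: "rep G x = replace_prefix u p v q" using rep_cong rep_nf by metis
    with idem have eq: "u = v" "p = q" by (simp_all add: replace_prefix_idem_iff)
    then have "A = gis_class G (Some (nf u p u p))"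
      using Ax x path_idem_words[OF 2(1)] rep rep_nf[OF 2(1) 2(1)] by (simp add: class_eq_iff)
    then show ?thesis using 2(1) by auto
  qed
next
  fix A assume "A \<in> {gis_class G (Some (nf u p u p)) | u p. \<exists>z. awalk u p z}"
  then obtain u p z where p: "awalk u p z" and A: "A = gis_class G (Some (nf u p u p))" by auto
  then show "A \<in> gis_idempotents G - {gis_zero G}"
    using path_idem_words[OF p] rep_nf[OF p p] replace_prefix_not_empty[of u p u p]
      class_idempotent_iff[OF path_idem_words[OF p]] class_zero_iff[OF path_idem_words[OF p]]
      replace_prefix_idem_iff[of u p u p]
    by simp
qed

text \<open>
  A vertex \<open>u\<close> fixes the trivial path at \<open>u\<close>, and so does every idempotent above it; among the
  idempotents \<open>p p\<^sup>*\<close> only \<open>u\<close> itself does. In the other direction \<open>p p\<^sup>*\<close> lies below the source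
  of \<open>p\<close>, and zero lies below every vertex, of which there is at least one.
\<close>

lemma maximal_idempotents:
  assumes "verts G \<noteq> {}"
  shows "gis_maximal_idempotents G = gis_vertex G ` verts G"
proof -
  have v_words: "Some [Vertex v] \<in> gis_words G" if "v \<in> verts G" for v using that by simp
  have v_rep: "rep G (Some [Vertex v]) = replace_prefix v [] v []" for v
    by (simp only: rep_simps word_act_vertex)
  have v_idem: "gis_vertex G v \<in> gis_idempotents G" if "v \<in> verts G" for v
    unfolding gis_vertex_def class_idempotent_iff[OF v_words[OF that]] v_rep
    by (simp add: replace_prefix_idem_iff)
  have v_nz: "gis_vertex G v \<noteq> gis_zero G" if "v \<in> verts G" for v
    unfolding gis_vertex_def class_zero_iff[OF v_words[OF that]] v_rep
    by (rule replace_prefix_not_empty)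
  have idem_cases: "A = gis_zero G \<or> (\<exists>u p z. awalk u p z \<and> A = gis_class G (Some (nf u p u p)))"
    if "A \<in> gis_idempotents G" for A
  proof (cases "A = gis_zero G")
    case False
    with that have "A \<in> gis_idempotents G - {gis_zero G}" by simp
    then show ?thesis unfolding nonzero_idempotents by auto
  qed simp
  show ?thesis
  proof (intro equalityI subsetI)
    fix A assume A: "A \<in> gis_maximal_idempotents G"
    then have max: "gis_vertex G v = A" if "v \<in> verts G" "gis_le G A (gis_vertex G v)" for v
      using v_idem that by (auto simp: gis_maximal_idempotents_def)
    from A have "A \<in> gis_idempotents G" by (simp add: gis_maximal_idempotents_def)
    from idem_cases[OF this] show "A \<in> gis_vertex G ` verts G"
    proof (elim disjE exE conjE)
      assume zero: "A = gis_zero G"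
      obtain v where v: "v \<in> verts G" using assms by auto
      have "gis_le G A (gis_vertex G v)"
        unfolding zero gis_zero_def gis_vertex_def class_le_iff[OF None_words v_words[OF v]] by simp
      then show ?thesis using max v v_nz zero by auto
    next
      fix u p z assume p: "awalk u p z" and eq: "A = gis_class G (Some (nf u p u p))"
      have u: "u \<in> verts G" using p by auto
      have "gis_le G A (gis_vertex G u)"
        unfolding eq gis_vertex_def class_le_iff[OF path_idem_words[OF p] v_words[OF u]]
          rep_nf[OF p p] v_rep
        by (auto simp: replace_prefix_def map_comp_def fun_eq_iff)
      then show ?thesis using max u by auto
    qed
  next
    fix A assume "A \<in> gis_vertex G ` verts G"
    then obtain u where u: "u \<in> verts G" and A: "A = gis_vertex G u" by auto
    have "B = A" if B: "B \<in> gis_idempotents G" and le: "gis_le G A B" for B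
      using idem_cases[OF B]
    proof (elim disjE exE conjE)
      assume "B = gis_zero G"
      then have "rep G (Some [Vertex u]) = Map.empty"
        using le class_le_iff[OF v_words[OF u] None_words] unfolding A gis_vertex_def gis_zero_def
        by simp
      then show ?thesis unfolding v_rep using replace_prefix_not_empty by metis
    next
      fix v p z assume p: "awalk v p z" and eq: "B = gis_class G (Some (nf v p v p))"
      have "replace_prefix u [] u [] = replace_prefix u [] u [] \<circ>\<^sub>m replace_prefix v p v p"
        using le unfolding A eq gis_vertex_def class_le_iff[OF v_words[OF u] path_idem_words[OF p]]
          rep_nf[OF p p] v_rep by simp
      from fun_cong[OF this, of "(u, [])"] have "v = u" "p = []"
        by (auto simp: replace_prefix_def map_comp_def split: if_splits)
      then show ?thesis
        using class_eq_iff[OF path_idem_words[OF p] v_words[OF u]] rep_nf[OF p p] v_rep[of u]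
        unfolding A eq gis_vertex_def by simp
    qed
    then show "A \<in> gis_maximal_idempotents G"
      using v_idem[OF u] A by (auto simp: gis_maximal_idempotents_def)
  qed
qed

end

theorem mainTheorem5:
  fixes G :: "('a, 'b) pre_digraph"
  assumes "wf_digraph G" and "verts G \<noteq> {}"
  shows "gis_idempotents G - {gis_zero G} =
      {gis_mult G (gis_path G u p) (gis_path_star G u p) | u p. \<exists>v. pre_digraph.awalk G u p v}
    \<and> gis_maximal_idempotents G = gis_vertex G ` verts G"
proof -
  interpret wf_digraph G by fact
  have "{gis_mult G (gis_path G u p) (gis_path_star G u p) | u p. \<exists>v. awalk u p v}
      = {gis_class G (Some (nf u p u p)) | u p. \<exists>v. awalk u p v}"
    using path_times_star by (intro Collect_cong) metis
  then show ?thesis using nonzero_idempotents maximal_idempotents[OF assms(2)] by simp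
qed

end
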